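(* Let $(\mathfrak g=\mathfrak g_{\bar 0}\oplus\mathfrak g_{\bar 1},B)$ be an odd-quadratic Lie superalgebra with $\dim\mathfrak g_{\bar 1}=m\ge 3$, such that $\mathfrak g_{\bar 1}$ is a weak filiform $\mathfrak g_{\bar 0}$-module with respect to the flag $\mathfrak g_{\bar 1}=V_m\supset\dots\supset V_2\supset V_1=\{0\}$, and let $e_m\in V_m$ be such that $V_m/V_{m-1}=\mathbb Ke_m$. Let $D$ be an odd skew-supersymmetric superderivation of $(\mathfrak g,B)$, $X_0\in\mathfrak g_{\bar 0}$ and $\lambda_0\in\mathbb K$ be such that $$D(X_0)=0,\qquad D^2=\tfrac12[X_0,\cdot]_{\mathfrak g},\qquad e_m\in D(\mathfrak g_{\bar 0}).$$ Define $\Omega:(\mathbb Ke)_{\bar 1}\to \mathrm{Der}(\mathfrak g\oplus P(\mathbb Ke^* ))$ by $\Omega(e):=\widetilde D$, where $\widetilde D(e^* )=0$ and $\widetilde D(X)=D(X)-(-1)^{i}B(X,X_0)e^*$ for $X\in\mathfrak g_{\bar i}$, and define the bilinear map $\zeta:\mathbb Ke\times\mathbb Ke\to\mathfrak g\oplus P(\mathbb Ke^* )$ by $\zeta(e,e):=X_0+\lambda_0e^*$. Then $\mathfrak t=\mathbb Ke\oplus\mathfrak g\oplus P(\mathbb Ke^* )$, endowed with the even skew-supersymmetric bilinear map $[\cdot,\cdot]:\mathfrak t\times\mathfrak t\to\mathfrak t$ given by $$[e,e]=X_0+\lambda_0e^*,\qquad [e,X]=D(X)-(-1)^{i}B(X,X_0)e^*\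 \ (X\in\mathfrak g_{\bar i}),$$ $$[X,Y]=[X,Y]_{\mathfrak g}+B(D(X),Y)e^*\ \ (X,Y\in\mathfrak g),\qquad [e^*,\mathfrak t]=0,$$ is a Lie superalgebra; more precisely, it is the generalized semi-direct product of $\mathfrak g\oplus P(\mathbb Ke^* )$ by the one-dimensional Lie superalgebra $(\mathbb Ke)_{\bar 1}$ (by means of $\Omega$ and $\zeta$). Moreover, the supersymmetric bilinear form $\widetilde B:\mathfrak t\times\mathfrak t\to\mathbb K$ defined by $\widetilde B|_{\mathfrak g\times\mathfrak g}=B$, $\widetilde B(e,e^* )=1$, $\widetilde B(\mathfrak g,e)=\widetilde B(\mathfrak g,e^* )=\{0\}$, $\widetilde B(e,e)=\widetilde B(e^*,e^* )=0$ is an odd-invariant scalar product on $\mathfrak t$. Furthermore, $\mathfrak t_{\bar 1}$ is a weak filiform $\mathfrak t_{\bar 0}$-module with respect to the flag $$\mathfrak t_{\bar 1}=\widetilde V_{m+1}\supset\dots\supset\widetilde V_2\supset\widetilde V_1=\{0\},\qquad \widetilde V_{m+1}:=\mathbb Ke\oplus V_m,\quad \widetilde V_i:=V_i\ \ (1\le i\le m).$$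
   Context: All Lie superalgebras are finite-dimensional over an algebraically closed field $\mathbb K$ of characteristic zero. A Lie superalgebra $\mathfrak g=\mathfrak g_{\bar 0}\oplus\mathfrak g_{\bar 1}$ is odd-quadratic, written $(\mathfrak g,B)$, if it carries a bilinear form $B:\mathfrak g\times\mathfrak g\to\mathbb K$ (called an odd-invariant scalar product) that is supersymmetric ($B(X,Y)=(-1)^{ij}B(Y,X)$ for $X\in\mathfrak g_{\bar i},Y\in\mathfrak g_{\bar j}$), invariant ($B([X,Y],Z)=B(X,[Y,Z])$), odd ($B(\mathfrak g_{\bar 0},\mathfrak g_{\bar 0})=B(\mathfrak g_{\bar 1},\mathfrak g_{\bar 1})=0$) and non-degenerate. If $\dim\mathfrak g_{\bar 1}=m>0$, then $\mathfrak g_{\bar 1}$ is a weak filiform $\mathfrak g_{\bar 0}$-module if there is a flag of subspaces $\mathfrak g_{\bar 1}=V_m\supset V_{m-1}\supset\dots\supset V_2\supset V_1=\{0\}$ with $\dim V_i=i$ and $[\mathfrak g_{\bar 0},V_i]=V_{i-1}$ for all $i\in\{2,\dots,m\}$, where $[\mathfrak g_{\bar 0},V_i]$ denotes the linear span of brackets (note the flag jumps from dimension $2$ to dimension $0$). Notation $V_i/V_{i-1}=\mathbb Ke_i$ for $3\le i\le m$ means that $e_i\in V_i$ represents a basis of the quotient. An odd skew-supersymmetric superderivation $D$ of $(\mathfrak g,B)$ is an odd linear map with $D([X,Y])=[D(X),Y]+(-1)^{i}[X,D(Y)]$ and $B(D(X),Y)=-(-1)^{i}B(X,D(Y))$ for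 $X\in\mathfrak g_{\bar i}$, $Y\in\mathfrak g$. $(\mathbb Ke)_{\bar 1}$ is the one-dimensional Lie superalgebra spanned by an odd element $e$ (zero bracket), $e^*$ is the dual vector, and $P(\mathbb Ke^* )$ is $\mathbb Ke^*$ with reversed parity, so $e^*$ is an even element of $\mathfrak t$: $\mathfrak t_{\bar 0}=\mathfrak g_{\bar 0}\oplus\mathbb Ke^*$, $\mathfrak t_{\bar 1}=\mathbb Ke\oplus\mathfrak g_{\bar 1}$. The space $\mathfrak g\oplus P(\mathbb Ke^* )$ is a Lie superalgebra with the central extension bracket $[X,Y]=[X,Y]_{\mathfrak g}+B(D(X),Y)e^*$ and $e^*$ central, and $\mathrm{Der}$ denotes its superderivations. The generalized semi-direct product of a Lie superalgebra $\mathfrak m$ by $(\mathbb Ke)_{\bar 1}$ by means of $\Omega$ and $\zeta$ is $\mathbb Ke\oplus\mathfrak m$ with bracket extending that of $\mathfrak m$, with $[e,x]=\Omega(e)(x)$ for $x\in\mathfrak m$ and $[e,e]=\zeta(e,e)$. The pair $(\mathfrak t,\widetilde B)$ constructed in the claim is called the generalized odd double extension of $(\mathfrak g,B)$ by $(\mathbb Ke)_{\bar 1}$ (by means of $D$, $X_0$, $\lambda_0$). *)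

theory Defs
  imports
    "HOL-Analysis.Product_Vector"
    "HOL-Computational_Algebra.Polynomial"
    "HOL-Library.Z2"
begin

text \<open>
  Parities are elements of the two-element field \<^typ>\<open>bit\<close>; a grading is a function
  \<open>G\<close> with \<open>G 0\<close> the even and \<open>G 1\<close> the odd part.  The
  underlying vector space is a whole type, with an explicit scalar multiplication.
\<close>

text \<open>\<open>psign i\<close> is $(-1)^i$, so that $(-1)^{ij}$ is \<open>psign (i * j)\<close>.\<close>

definition psign :: "bit \<Rightarrow> 'k::field" where
  "psign i = (if i = 0 then 1 else - 1)"

definition bilinear_map ::
  "('k::field \<Rightarrow> 'a::ab_group_add \<Rightarrow> 'a) \<Rightarrow> ('k \<Rightarrow> 'b::ab_group_add \<Rightarrow> 'b) \<Rightarrow>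
   ('k \<Rightarrow> 'c::ab_group_add \<Rightarrow> 'c) \<Rightarrow> ('a \<Rightarrow> 'b \<Rightarrow> 'c) \<Rightarrow> bool" where
  "bilinear_map s1 s2 s3 f \<longleftrightarrow>
     (\<forall>x. Vector_Spaces.linear s2 s3 (\<lambda>y. f x y)) \<and>
     (\<forall>y. Vector_Spaces.linear s1 s3 (\<lambda>x. f x y))"

locale lie_superalgebra = vector_space scl
  for scl :: "'k::field_char_0 \<Rightarrow> 'g::ab_group_add \<Rightarrow> 'g" +
  fixes G :: "bit \<Rightarrow> 'g set"
    and br :: "'g \<Rightarrow> 'g \<Rightarrow> 'g"
  assumes finite_dimensional: "\<exists>S. finite S \<and> span S = UNIV"
    and subspace_grading: "\<And>i. subspace (G i)"
    and grading_sum: "\<And>x. \<exists>u\<in>G 0. \<exists>v\<in>G 1. x = u + v"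
    and grading_inter: "G 0 \<inter> G 1 = {0}"
    and br_bilinear: "bilinear_map scl scl scl br"
    and br_even: "\<And>i j x y. x \<in> G i \<Longrightarrow> y \<in> G j \<Longrightarrow> br x y \<in> G (i + j)"
    and br_skew: "\<And>i j x y. x \<in> G i \<Longrightarrow> y \<in> G j \<Longrightarrow>
      br x y = - scl (psign (i * j)) (br y x)"
    and super_jacobi: "\<And>i j x y z. x \<in> G i \<Longrightarrow> y \<in> G j \<Longrightarrow>
      br x (br y z) = br (br x y) z + scl (psign (i * j)) (br y (br x z))"

locale odd_quadratic_lie_superalgebra = lie_superalgebra scl G br
  for scl :: "'k::field_char_0 \<Rightarrow> 'g::ab_group_add \<Rightarrow> 'g" and G br +
  fixes B :: "'g \<Rightarrow> 'g \<Rightarrow> 'k"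
  assumes form_bilinear: "bilinear_map scl scl (*) B"
    and form_supersymmetric: "\<And>i j x y. x \<in> G i \<Longrightarrow> y \<in> G j \<Longrightarrow>
      B x y = psign (i * j) * B y x"
    and form_invariant: "\<And>x y z. B (br x y) z = B x (br y z)"
    and form_odd: "\<And>i x y. x \<in> G i \<Longrightarrow> y \<in> G i \<Longrightarrow> B x y = 0"
    and form_nondegenerate: "\<And>x. (\<forall>y. B x y = 0) \<Longrightarrow> x = 0"

definition odd_superderivation ::
  "('k::field \<Rightarrow> 'g::ab_group_add \<Rightarrow> 'g) \<Rightarrow> (bit \<Rightarrow> 'g set) \<Rightarrow> ('g \<Rightarrow> 'g \<Rightarrow> 'g) \<Rightarrow>
   ('g \<Rightarrow> 'g) \<Rightarrow> bool" where
  "odd_superderivation scl G br D \<longleftrightarrow>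
     Vector_Spaces.linear scl scl D \<and>
     (\<forall>i. \<forall>x\<in>G i. D x \<in> G (i + 1)) \<and>
     (\<forall>i. \<forall>x\<in>G i. \<forall>y. D (br x y) = br (D x) y + scl (psign i) (br x (D y)))"

definition odd_skew_superderivation ::
  "('k::field \<Rightarrow> 'g::ab_group_add \<Rightarrow> 'g) \<Rightarrow> (bit \<Rightarrow> 'g set) \<Rightarrow> ('g \<Rightarrow> 'g \<Rightarrow> 'g) \<Rightarrow>
   ('g \<Rightarrow> 'g \<Rightarrow> 'k) \<Rightarrow> ('g \<Rightarrow> 'g) \<Rightarrow> bool" where
  "odd_skew_superderivation scl G br B D \<longleftrightarrow>
     odd_superderivation scl G br D \<and>
     (\<forall>i. \<forall>x\<in>G i. \<forall>y. B (D x) y = - psign i * B x (D y))"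

text \<open>
  \<open>V\<close> is used only at the indices \<open>1, \<dots>, m\<close>.  The dimension condition starts at
  \<open>2\<close>, because \<open>V 1\<close> is the zero space.
\<close>

definition weak_filiform ::
  "('k::field \<Rightarrow> 'g::ab_group_add \<Rightarrow> 'g) \<Rightarrow> (bit \<Rightarrow> 'g set) \<Rightarrow> ('g \<Rightarrow> 'g \<Rightarrow> 'g) \<Rightarrow>
   nat \<Rightarrow> (nat \<Rightarrow> 'g set) \<Rightarrow> bool" where
  "weak_filiform scl G br m V \<longleftrightarrow>
     0 < m \<and> vector_space.dim scl (G 1) = m \<and>
     V m = G 1 \<and> V 1 = {0} \<and>
     (\<forall>i\<in>{1..m}. module.subspace scl (V i)) \<and>
     (\<forall>i\<in>{2..m}. V (i - 1) \<subset> V i \<and> vector_space.dim scl (V i) = i \<and>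
        module.span scl {br x v | x v. x \<in> G 0 \<and> v \<in> V i} = V (i - 1))"

text \<open>The class of \<open>e\<close> is a basis of the (one-dimensional) quotient \<open>V / W\<close>.\<close>

definition quotient_basis ::
  "('k \<Rightarrow> 'g::ab_group_add \<Rightarrow> 'g) \<Rightarrow> 'g set \<Rightarrow> 'g set \<Rightarrow> 'g \<Rightarrow> bool" where
  "quotient_basis scl V W e \<longleftrightarrow>
     e \<in> V \<and> e \<notin> W \<and> (\<forall>v\<in>V. \<exists>c. v - scl c e \<in> W)"

text \<open>
  The linear map $X \mapsto (-1)^i X$ for $X$ of parity $i$ (see \<open>parity_map_homogeneous\<close>
  below); it extends the sign-dependent formulas to inhomogeneous vectors.
\<close>

definition parity_map :: "(bit \<Rightarrow> 'g set) \<Rightarrow> 'g::ab_group_add \<Rightarrow> 'g" where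
  "parity_map G x = (THE y. \<exists>u\<in>G 0. \<exists>v\<in>G 1. x = u + v \<and> y = u - v)"

text \<open>
  Central extension $\mathfrak g \oplus P(\mathbb K e^*)$: the pair \<open>(X, s)\<close> stands for
  $X + s e^*$, and $e^*$ is even.
\<close>

definition cext_scale ::
  "('k::field \<Rightarrow> 'g::ab_group_add \<Rightarrow> 'g) \<Rightarrow> 'k \<Rightarrow> 'g \<times> 'k \<Rightarrow> 'g \<times> 'k" where
  "cext_scale scl = module_prod.scale scl (*)"

definition cext_grading :: "(bit \<Rightarrow> 'g set) \<Rightarrow> bit \<Rightarrow> ('g \<times> 'k::field) set" where
  "cext_grading G i = (if i = 0 then G 0 \<times> UNIV else G 1 \<times> {0})"

definition cext_bracket ::
  "('g \<Rightarrow> 'g \<Rightarrow> 'g) \<Rightarrow> ('g \<Rightarrow> 'g \<Rightarrow> 'k::field) \<Rightarrow> ('g \<Rightarrow> 'g) \<Rightarrow>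
   'g \<times> 'k \<Rightarrow> 'g \<times> 'k \<Rightarrow> 'g \<times> 'k" where
  "cext_bracket br B D = (\<lambda>(X, s) (Y, t). (br X Y, B (D X) Y))"

text \<open>
  The space $\mathbb K e \oplus \mathfrak m$ with $e$ odd: the pair \<open>(a, x)\<close> stands for
  $a e + x$.
\<close>

definition odd_line_scale ::
  "('k::field \<Rightarrow> 'm::ab_group_add \<Rightarrow> 'm) \<Rightarrow> 'k \<Rightarrow> 'k \<times> 'm \<Rightarrow> 'k \<times> 'm" where
  "odd_line_scale scl = module_prod.scale (*) scl"

definition odd_line_grading :: "(bit \<Rightarrow> 'm set) \<Rightarrow> bit \<Rightarrow> ('k::field \<times> 'm) set" where
  "odd_line_grading M i = (if i = 0 then {0} \<times> M 0 else UNIV \<times> M 1)"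

text \<open>
  \<open>brT\<close> makes $\mathbb K e \oplus \mathfrak m$ the generalized semi-direct product of
  $\mathfrak m$ by the abelian Lie superalgebra $(\mathbb K e)_{\bar 1}$ by means of
  \<open>\<Omega>\<close> and \<open>\<zeta>\<close>.  Here \<open>\<Omega> a\<close> and \<open>\<zeta> a b\<close>
  stand for $\Omega(ae)$ and $\zeta(ae, be)$.  Both maps are even; as $e$ is odd, \<open>\<Omega>\<close>
  takes values in the odd superderivations of $\mathfrak m$, and \<open>\<zeta>\<close> in its even part.
\<close>

definition generalized_semidirect_product ::
  "('k::field_char_0 \<Rightarrow> 'm::ab_group_add \<Rightarrow> 'm) \<Rightarrow> (bit \<Rightarrow> 'm set) \<Rightarrow> ('m \<Rightarrow> 'm \<Rightarrow> 'm) \<Rightarrow>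
   ('k \<Rightarrow> 'm \<Rightarrow> 'm) \<Rightarrow> ('k \<Rightarrow> 'k \<Rightarrow> 'm) \<Rightarrow> ('k \<times> 'm \<Rightarrow> 'k \<times> 'm \<Rightarrow> 'k \<times> 'm) \<Rightarrow> bool" where
  "generalized_semidirect_product scl M br \<Omega> \<zeta> brT \<longleftrightarrow>
     lie_superalgebra scl M br \<and>
     (\<forall>x. Vector_Spaces.linear (*) scl (\<lambda>a. \<Omega> a x)) \<and>
     (\<forall>a. odd_superderivation scl M br (\<Omega> a)) \<and>
     bilinear_map (*) (*) scl \<zeta> \<and> (\<forall>a b. \<zeta> a b \<in> M 0) \<and>
     lie_superalgebra (odd_line_scale scl) (odd_line_grading M) brT \<and>
     (\<forall>x y. brT (0, x) (0, y) = (0, br x y)) \<and>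
     (\<forall>a x. brT (a, 0) (0, x) = (0, \<Omega> a x)) \<and>
     (\<forall>a b. brT (a, 0) (b, 0) = (0, \<zeta> a b))"

text \<open>
  \<open>gode_derivation\<close> is $\widetilde D$ (\<open>gode\<close> abbreviates generalized odd
  double extension).  \<open>gode_Omega\<close> and \<open>gode_zeta\<close> are the linear and bilinear
  maps determined by $\Omega(e) = \widetilde D$ and $\zeta(e, e) = X_0 + \lambda_0 e^*$.
\<close>

definition gode_derivation ::
  "(bit \<Rightarrow> 'g set) \<Rightarrow> ('g::ab_group_add \<Rightarrow> 'g \<Rightarrow> 'k::field) \<Rightarrow> ('g \<Rightarrow> 'g) \<Rightarrow> 'g \<Rightarrow>
   'g \<times> 'k \<Rightarrow> 'g \<times> 'k" where
  "gode_derivation G B D X0 = (\<lambda>(X, s). (D X, - B (parity_map G X) X0))"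

definition gode_Omega ::
  "('k::field \<Rightarrow> 'g::ab_group_add \<Rightarrow> 'g) \<Rightarrow> (bit \<Rightarrow> 'g set) \<Rightarrow> ('g \<Rightarrow> 'g \<Rightarrow> 'k) \<Rightarrow>
   ('g \<Rightarrow> 'g) \<Rightarrow> 'g \<Rightarrow> 'k \<Rightarrow> 'g \<times> 'k \<Rightarrow> 'g \<times> 'k" where
  "gode_Omega scl G B D X0 a x = cext_scale scl a (gode_derivation G B D X0 x)"

definition gode_zeta ::
  "('k::field \<Rightarrow> 'g::ab_group_add \<Rightarrow> 'g) \<Rightarrow> 'g \<Rightarrow> 'k \<Rightarrow> 'k \<Rightarrow> 'k \<Rightarrow> 'g \<times> 'k" where
  "gode_zeta scl X0 l0 a b = cext_scale scl (a * b) (X0, l0)"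

text \<open>
  The generalized odd double extension
  $\mathfrak t = \mathbb K e \oplus \mathfrak g \oplus P(\mathbb K e^*)$: the triple
  \<open>(a, X, s)\<close> stands for $a e + X + s e^*$.  The terms in \<open>b\<close> alone come from
  $[X, e] = -(-1)^i [e, X]$ for $X \in \mathfrak g_{\bar i}$;
  see \<open>gode_bracket_table\<close> for the values of the bracket.
\<close>

definition gode_scale ::
  "('k::field \<Rightarrow> 'g::ab_group_add \<Rightarrow> 'g) \<Rightarrow> 'k \<Rightarrow> 'k \<times> 'g \<times> 'k \<Rightarrow> 'k \<times> 'g \<times> 'k" where
  "gode_scale scl = odd_line_scale (cext_scale scl)"

definition gode_grading :: "(bit \<Rightarrow> 'g set) \<Rightarrow> bit \<Rightarrow> ('k::field \<times> 'g \<times> 'k) set" where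
  "gode_grading G = odd_line_grading (cext_grading G)"

definition gode_bracket ::
  "('k::field \<Rightarrow> 'g::ab_group_add \<Rightarrow> 'g) \<Rightarrow> (bit \<Rightarrow> 'g set) \<Rightarrow> ('g \<Rightarrow> 'g \<Rightarrow> 'g) \<Rightarrow>
   ('g \<Rightarrow> 'g \<Rightarrow> 'k) \<Rightarrow> ('g \<Rightarrow> 'g) \<Rightarrow> 'g \<Rightarrow> 'k \<Rightarrow>
   'k \<times> 'g \<times> 'k \<Rightarrow> 'k \<times> 'g \<times> 'k \<Rightarrow> 'k \<times> 'g \<times> 'k" where
  "gode_bracket scl G br B D X0 l0 = (\<lambda>(a, X, s) (b, Y, t).
     (0,
      scl (a * b) X0 + scl a (D Y) - scl b (D (parity_map G X)) + br X Y,
      a * b * l0 - a * B (parity_map G Y) X0 + b * B X X0 + B (D X) Y))"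

definition gode_form ::
  "('g \<Rightarrow> 'g \<Rightarrow> 'k::field) \<Rightarrow> 'k \<times> 'g \<times> 'k \<Rightarrow> 'k \<times> 'g \<times> 'k \<Rightarrow> 'k" where
  "gode_form B = (\<lambda>(a, X, s) (b, Y, t). B X Y + a * t + s * b)"

definition gode_flag ::
  "nat \<Rightarrow> (nat \<Rightarrow> 'g set) \<Rightarrow> nat \<Rightarrow> ('k::field \<times> 'g \<times> 'k) set" where
  "gode_flag m V i = (if i = m + 1 then UNIV \<times> V m \<times> {0} else {0} \<times> V i \<times> {0})"

lemma (in lie_superalgebra) parity_map_add:
  assumes "u \<in> G 0" "v \<in> G 1"
  shows "parity_map G (u + v) = u - v"
  unfolding parity_map_def
proof (rule the_equality)
  show "\<exists>u'\<in>G 0. \<exists>v'\<in>G 1. u + v = u' + v' \<and> u - v = u' - v'"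
    using assms by blast
next
  fix y assume "\<exists>u'\<in>G 0. \<exists>v'\<in>G 1. u + v = u' + v' \<and> y = u' - v'"
  then obtain u' v' where *: "u' \<in> G 0" "v' \<in> G 1" "u + v = u' + v'" "y = u' - v'"
    by blast
  have eq: "u - u' = v' - v"
    using *(3) by (simp add: algebra_simps)
  have "u - u' \<in> G 0" "v' - v \<in> G 1"
    using assms * subspace_grading subspace_diff by blast+
  with eq grading_inter have "u - u' = 0" "v' - v = 0"
    by (metis IntI singletonD)+
  with * show "y = u - v" by simp
qed

lemma (in lie_superalgebra) parity_map_homogeneous:
  assumes "x \<in> G i"
  shows "parity_map G x = scl (psign i) x"
proof (cases "i = 0")
  case True
  then show ?thesis
    using parity_map_add[of x 0] assms subspace_grading subspace_0
    by (simp add: psign_def)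
next
  case False
  then show ?thesis
    using parity_map_add[of 0 x] assms subspace_grading subspace_0
    by (simp add: psign_def)
qed

lemma (in odd_quadratic_lie_superalgebra) gode_bracket_table:
  fixes D :: "'g \<Rightarrow> 'g" and X0 :: 'g and l0 :: 'k
  assumes D: "Vector_Spaces.linear scl scl D"
  defines "brT \<equiv> gode_bracket scl G br B D X0 l0"
  defines "e \<equiv> (1, 0, 0)" and "estar \<equiv> (0, 0, 1)"
  shows "brT e e = (0, X0, l0)"
    and "X \<in> G i \<Longrightarrow> brT e (0, X, 0) = (0, D X, - psign i * B X X0)"
    and "X \<in> G i \<Longrightarrow> brT (0, X, 0) e = - gode_scale scl (psign i) (brT e (0, X, 0))"
    and "brT (0, X, 0) (0, Y, 0) = (0, br X Y, B (D X) Y)"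
    and "brT estar z = 0"
    and "brT z estar = 0"
proof -
  have z: "parity_map G 0 = 0"
    using parity_map_add[of 0 0] subspace_grading subspace_0 by simp
  interpret D: Vector_Spaces.linear scl scl D by (fact D)
  have Bz: "B 0 y = 0" "B (scl c x) y = c * B x y" for c x y
    using form_bilinear unfolding bilinear_map_def Vector_Spaces.linear_iff
    by (metis mult_zero_left scale_zero_left, simp)
  have Bz': "B y 0 = 0" for y
    using form_bilinear unfolding bilinear_map_def Vector_Spaces.linear_iff
    by (metis mult_zero_left scale_zero_left)
  have brz: "br 0 y = 0" "br y 0 = 0" for y
    using br_bilinear unfolding bilinear_map_def Vector_Spaces.linear_iff
    by (metis scale_zero_left)+
  interpret k: vector_space "(*) :: 'k \<Rightarrow> 'k \<Rightarrow> 'k"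
    by standard (simp_all add: algebra_simps)
  interpret c: vector_space_prod scl "(*) :: 'k \<Rightarrow> 'k \<Rightarrow> 'k" ..
  interpret t: vector_space_prod "(*) :: 'k \<Rightarrow> 'k \<Rightarrow> 'k" c.scale ..
  have sc: "gode_scale scl r (a, x, s) = (r * a, scl r x, r * s)" for r a x s
    by (simp add: gode_scale_def odd_line_scale_def cext_scale_def t.scale_prod c.scale_prod)
  have ps: "psign i * psign i = (1::'k)" for i
    by (simp add: psign_def)
  note simps = assms(2-) gode_bracket_def z Bz Bz' brz D.zero D.scale sc
  show "brT e e = (0, X0, l0)" by (simp add: simps)
  show e: "X \<in> G i \<Longrightarrow> brT e (0, X, 0) = (0, D X, - psign i * B X X0)"
    by (simp add: simps parity_map_homogeneous)
  show "X \<in> G i \<Longrightarrow> brT (0, X, 0) e = - gode_scale scl (psign i) (brT e (0, X, 0))"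
    by (simp add: simps parity_map_homogeneous ps)
  show "brT (0, X, 0) (0, Y, 0) = (0, br X Y, B (D X) Y)" by (simp add: simps)
  show "brT estar z = 0" "brT z estar = 0"
    by (simp_all add: simps zero_prod_def split: prod.split)
qed

end

theory Submission
  imports Defs
begin

text \<open>
  The Lie superalgebra $\mathfrak t$ is reached from $\mathfrak g$ by two general extensions.

  First, $\omega(X, Y) = B(D(X), Y)$ is an even 2-cocycle: it is skew-supersymmetric because $B$ is
  symmetric and $D$ is skew-supersymmetric with respect to $B$, and the cocycle identity is the derivation
  property of $D$ rewritten by invariance.  So $\mathfrak m = \mathfrak g \oplus P(\mathbb K e^*)$ is a
  central extension (\<open>lie_superalgebra_cext\<close>).

  Second, an odd superderivation $\delta$ of any Lie superalgebra $\mathfrak m$ and an even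
  $x_0 \in \mathfrak m$ turn $\mathbb K e \oplus \mathfrak m$ into a Lie superalgebra with
  $[e, e] = x_0$ and $[e, x] = \delta(x)$ as soon as $\delta(x_0) = 0$ and
  $\delta^2 = \frac12 [x_0, \cdot]$: these are the Jacobi identities for the triples $(e, e, e)$ and
  $(e, e, x)$, while the triple $(e, x, y)$ is the derivation property
  (\<open>lie_superalgebra_odd_line\<close>).

  It remains to check these conditions for $\widetilde D$ and $X_0 + \lambda_0 e^*$.  Since $B$ is odd, the
  $e^*$-coefficient of $\widetilde D(X)$ is simply $B(X, X_0)$, and $\widetilde D$ is a superderivation because,
  for $X$ of parity $i$, $B([X, Y], X_0) = B([X_0, X], Y) = 2 B(D^2(X), Y)$, which skewness of $D$ splits evenly between
  $B(D^2(X), Y)$ and $(-1)^i B(D(X), D(Y))$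
  (\<open>odd_superderivation_gode_derivation\<close>).

  The form on $\mathfrak t$ is invariant by a direct computation from the invariance of $B$ and the skewness
  of $D$.  In the flag only the step from $\widetilde V_{m+1}$ to $\widetilde V_m = V_m$ is new.  The brackets
  $[X, ae + Y] = [X, Y] - a D(X)$, for $X$ even and $Y$ odd, have no $e^*$-component since $B$ is odd;
  they span $[\mathfrak g_{\bar 0}, V_m] = V_{m-1}$ together with $D(\mathfrak g_{\bar 0})$, and the
  hypothesis $e_m \in D(\mathfrak g_{\bar 0})$ supplies the missing dimension of $V_m$
  (\<open>weak_filiform_gode\<close>).
\<close>

section \<open>Signs, bilinear maps and products of vector spaces\<close>

lemma psign_simps [simp]: "psign 0 = 1" "psign 1 = - 1"
  by (simp_all add: psign_def)

lemma psign_square [simp]: "psign i * psign i = (1 :: 'k::field)"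
  by (simp add: psign_def)

lemma vector_space_field_mult: "vector_space ((*) :: 'k::field \<Rightarrow> 'k \<Rightarrow> 'k)"
  by standard (simp_all add: algebra_simps)

lemma field_mult_span_one: "module.span ((*) :: 'k::field \<Rightarrow> 'k \<Rightarrow> 'k) {1} = UNIV"
proof -
  interpret k: vector_space "(*) :: 'k \<Rightarrow> 'k \<Rightarrow> 'k" by (rule vector_space_field_mult)
  show ?thesis by (simp add: k.span_singleton full_SetCompr_eq)
qed

lemma dim_field_UNIV: "vector_space.dim ((*) :: 'k::field \<Rightarrow> 'k \<Rightarrow> 'k) UNIV = 1"
proof -
  interpret k: vector_space "(*) :: 'k \<Rightarrow> 'k \<Rightarrow> 'k" by (rule vector_space_field_mult)
  have "k.dim (k.span {1}) = card {1 :: 'k}"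
    by (rule k.dim_span_eq_card_independent) simp
  then show ?thesis by (simp add: field_mult_span_one)
qed

lemma dim_field_zero: "vector_space.dim ((*) :: 'k::field \<Rightarrow> 'k \<Rightarrow> 'k) {0} = 0"
proof -
  interpret k: vector_space "(*) :: 'k \<Rightarrow> 'k \<Rightarrow> 'k" by (rule vector_space_field_mult)
  have "k.dim (k.span {}) = card ({} :: 'k set)"
    by (rule k.dim_span_eq_card_independent) (rule k.independent_empty)
  then show ?thesis by simp
qed

lemma bilinear_map_iff:
  assumes "vector_space s1" "vector_space s2" "vector_space s3"
  shows "bilinear_map s1 s2 s3 f \<longleftrightarrow>
    (\<forall>x y z. f (x + y) z = f x z + f y z) \<and> (\<forall>x y z. f x (y + z) = f x y + f x z) \<and>
    (\<forall>c x y. f (s1 c x) y = s3 c (f x y)) \<and> (\<forall>c x y. f x (s2 c y) = s3 c (f x y))"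
  using assms unfolding bilinear_map_def Vector_Spaces.linear_iff by blast

text \<open>
  Finite dimensionality is given by a finite spanning set, without a fixed basis.  The following
  lemmas choose bases in order to carry over what is known for products of vector spaces with
  fixed bases.
\<close>

context
  fixes s1 :: "'k::field \<Rightarrow> 'a::ab_group_add \<Rightarrow> 'a" and s2 :: "'k \<Rightarrow> 'b::ab_group_add \<Rightarrow> 'b"
  assumes vs1: "vector_space s1" and fd1: "\<exists>S. finite S \<and> module.span s1 S = UNIV"
    and vs2: "vector_space s2" and fd2: "\<exists>S. finite S \<and> module.span s2 S = UNIV"
begin

lemma finite_dimensional_prod_obtain:
  obtains B1 B2 where "finite_dimensional_vector_space_prod s1 s2 B1 B2"
proof -
  interpret v1: vector_space s1 by (rule vs1)
  interpret v2: vector_space s2 by (rule vs2)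
  obtain S1 where S1: "finite S1" "v1.span S1 = UNIV" using fd1 by blast
  obtain S2 where S2: "finite S2" "v2.span S2 = UNIV" using fd2 by blast
  obtain B1 where B1: "B1 \<subseteq> S1" "v1.independent B1" "S1 \<subseteq> v1.span B1"
    by (rule v1.maximal_independent_subset)
  obtain B2 where B2: "B2 \<subseteq> S2" "v2.independent B2" "S2 \<subseteq> v2.span B2"
    by (rule v2.maximal_independent_subset)
  have "v1.span B1 = UNIV" "v2.span B2 = UNIV"
    using v1.span_minimal[OF B1(3) v1.subspace_span] v2.span_minimal[OF B2(3) v2.subspace_span]
    by (simp_all add: S1 S2 top_unique)
  moreover have "finite B1" "finite B2"
    using finite_subset[OF B1(1) S1(1)] finite_subset[OF B2(1) S2(1)] by simp_all
  ultimately have "finite_dimensional_vector_space_prod s1 s2 B1 B2"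
    using B1 B2 by unfold_locales auto
  then show thesis by (rule that)
qed

lemma vector_space_prod_scale: "vector_space (module_prod.scale s1 s2)"
proof -
  interpret v1: vector_space s1 by (rule vs1)
  interpret v2: vector_space s2 by (rule vs2)
  interpret vector_space_prod s1 s2 ..
  show ?thesis by (rule p.vector_space_axioms)
qed

lemma finite_span_prod: "\<exists>S. finite S \<and> module.span (module_prod.scale s1 s2) S = UNIV"
proof -
  obtain B1 B2 where "finite_dimensional_vector_space_prod s1 s2 B1 B2"
    by (rule finite_dimensional_prod_obtain)
  then interpret finite_dimensional_vector_space_prod s1 s2 B1 B2 .
  show ?thesis using p.finite_Basis p.span_Basis by blast
qed

lemma dim_prod_Times:
  assumes "module.subspace s1 S" "module.subspace s2 T"
  shows "vector_space.dim (module_prod.scale s1 s2) (S \<times> T) =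
    vector_space.dim s1 S + vector_space.dim s2 T"
proof -
  obtain B1 B2 where "finite_dimensional_vector_space_prod s1 s2 B1 B2"
    by (rule finite_dimensional_prod_obtain)
  then interpret finite_dimensional_vector_space_prod s1 s2 B1 B2 .
  show ?thesis using dim_Times assms by blast
qed

end

section \<open>Lie superalgebras and their parity maps\<close>

context lie_superalgebra
begin

lemma br_linear:
  shows br_add_left: "br (x + y) z = br x z + br y z"
    and br_add_right: "br x (y + z) = br x y + br x z"
    and br_scale_left: "br (scl c x) y = scl c (br x y)"
    and br_scale_right: "br x (scl c y) = scl c (br x y)"
    and br_zero: "br 0 y = 0" "br x 0 = 0"
    and br_minus: "br (- x) y = - br x y" "br x (- y) = - br x y"
    and br_diff: "br (x - y) z = br x z - br y z" "br x (y - z) = br x y - br x z"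
proof -
  note b = br_bilinear[unfolded bilinear_map_iff[OF vector_space_axioms vector_space_axioms
        vector_space_axioms]]
  show add: "br (x + y) z = br x z + br y z" "br x (y + z) = br x y + br x z"
    and sc: "br (scl c x) y = scl c (br x y)" "br x (scl c y) = scl c (br x y)" for x y z c
    by (rule b[THEN conjunct1, rule_format] b[THEN conjunct2, THEN conjunct1, rule_format]
        b[THEN conjunct2, THEN conjunct2, THEN conjunct1, rule_format]
        b[THEN conjunct2, THEN conjunct2, THEN conjunct2, rule_format])+
  show "br 0 y = 0" "br x 0 = 0"
    using sc[of 0 0 y] sc(2)[of x 0 0] by simp_all
  show m: "br (- x) y = - br x y" "br x (- y) = - br x y" for x y
    using sc(1)[of "- 1" x y] sc(2)[of x "- 1" y] by simp_all
  show "br (x - y) z = br x z - br y z" "br x (y - z) = br x y - br x z"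
    using add(1)[of x "- y" z] add(2)[of x y "- z"] by (simp_all add: m)
qed

lemma grading_closed:
  shows "0 \<in> G i" "x \<in> G i \<Longrightarrow> y \<in> G i \<Longrightarrow> x + y \<in> G i" "x \<in> G i \<Longrightarrow> y \<in> G i \<Longrightarrow> x - y \<in> G i"
    "x \<in> G i \<Longrightarrow> scl c x \<in> G i" "x \<in> G i \<Longrightarrow> - x \<in> G i"
  by (simp_all add: subspace_grading subspace_0 subspace_add subspace_diff subspace_scale
      subspace_neg)

lemma parity_map_linear:
  shows "parity_map G (x + y) = parity_map G x + parity_map G y"
    and "parity_map G (scl c x) = scl c (parity_map G x)"
proof -
  obtain u v where x: "u \<in> G 0" "v \<in> G 1" "x = u + v" using grading_sum by blast
  obtain u' v' where y: "u' \<in> G 0" "v' \<in> G 1" "y = u' + v'" using grading_sum by blast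
  have "parity_map G ((u + u') + (v + v')) = (u + u') - (v + v')"
    using x y by (intro parity_map_add grading_closed)
  then show "parity_map G (x + y) = parity_map G x + parity_map G y"
    using x y by (simp add: parity_map_add algebra_simps)
  have "parity_map G (scl c u + scl c v) = scl c u - scl c v"
    using x by (intro parity_map_add grading_closed)
  then show "parity_map G (scl c x) = scl c (parity_map G x)"
    using x by (simp add: parity_map_add algebra_simps)
qed

lemma odd_superderivationD:
  assumes "odd_superderivation scl G br D"
  shows "D (x + y) = D x + D y" "D (scl c x) = scl c (D x)" "D 0 = 0" "D (- x) = - D x"
    "D (x - y) = D x - D y"
    "x \<in> G i \<Longrightarrow> D x \<in> G (i + 1)"
    "x \<in> G i \<Longrightarrow> D (br x y) = br (D x) y + scl (psign i) (br x (D y))"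
proof -
  interpret D: Vector_Spaces.linear scl scl D
    using assms by (simp add: odd_superderivation_def)
  show "D (x + y) = D x + D y" "D (scl c x) = scl c (D x)" "D 0 = 0" "D (- x) = - D x"
    "D (x - y) = D x - D y"
    by (fact D.add D.scale D.zero D.neg D.diff)+
qed (use assms in \<open>auto simp: odd_superderivation_def\<close>)

lemma odd_line_scale_apply: "odd_line_scale scl c (a, x) = (c * a, scl c x)"
proof -
  interpret k: vector_space "(*) :: 'k \<Rightarrow> 'k \<Rightarrow> 'k" by (rule vector_space_field_mult)
  interpret vector_space_prod "(*) :: 'k \<Rightarrow> 'k \<Rightarrow> 'k" scl ..
  show ?thesis by (simp add: odd_line_scale_def scale_prod)
qed

lemma cext_scale_apply: "cext_scale scl c (x, s) = (scl c x, c * s)"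
proof -
  interpret k: vector_space "(*) :: 'k \<Rightarrow> 'k \<Rightarrow> 'k" by (rule vector_space_field_mult)
  interpret vector_space_prod scl "(*) :: 'k \<Rightarrow> 'k \<Rightarrow> 'k" ..
  show ?thesis by (simp add: cext_scale_def scale_prod)
qed

lemma ex_finite_span_field: "\<exists>S. finite S \<and> module.span ((*) :: 'k \<Rightarrow> 'k \<Rightarrow> 'k) S = UNIV"
  using field_mult_span_one by blast

text \<open>
  The hypotheses of the lemmas on products, for a product with the line \<open>'k\<close> on the left
  and on the right.
\<close>

lemmas line_prod = vector_space_field_mult ex_finite_span_field vector_space_axioms
  finite_dimensional

lemmas prod_line = vector_space_axioms finite_dimensional vector_space_field_mult
  ex_finite_span_field

end

section \<open>Extension of a Lie superalgebra by an odd line\<close>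

text \<open>
  The bracket on $\mathbb K e \oplus \mathfrak m$ with $[e, e] = x_0$ and $[e, x] = \delta(x)$.  The parity map
  encodes the sign in $[x, e] = -(-1)^i [e, x]$ for $x$ of parity $i$.
\<close>

definition odd_line_bracket ::
  "('k::field \<Rightarrow> 'm::ab_group_add \<Rightarrow> 'm) \<Rightarrow> (bit \<Rightarrow> 'm set) \<Rightarrow> ('m \<Rightarrow> 'm \<Rightarrow> 'm) \<Rightarrow>
   ('m \<Rightarrow> 'm) \<Rightarrow> 'm \<Rightarrow> 'k \<times> 'm \<Rightarrow> 'k \<times> 'm \<Rightarrow> 'k \<times> 'm" where
  "odd_line_bracket scl M br \<delta> x0 = (\<lambda>(a, x) (b, y).
     (0, scl (a * b) x0 + scl a (\<delta> y) - scl b (\<delta> (parity_map M x)) + br x y))"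

text \<open>
  A homogeneous element of parity $i$ is $ae + x$ with $x$ of parity $i$, and $a = 0$ if $i = 0$.
  In the Jacobi identity for two homogeneous elements and an arbitrary third one, the term that is
  cubic in $e$ is a multiple of $\delta(x_0) = 0$, and the quadratic ones are all multiples of some $\delta^2(y)$ once $[x_0, y]$ is replaced by
  $2 \delta^2(y)$; the terms linear in $e$ cancel by the derivation property, and the rest is the
  Jacobi identity of $\mathfrak m$.
\<close>

lemma (in lie_superalgebra) lie_superalgebra_odd_line:
  assumes der: "odd_superderivation scl G br \<delta>"
    and x0: "x0 \<in> G 0" and \<delta>x0: "\<delta> x0 = 0"
    and sq: "\<And>x. \<delta> (\<delta> x) = scl (1 / 2) (br x0 x)"
  shows "lie_superalgebra (odd_line_scale scl) (odd_line_grading G)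
    (odd_line_bracket scl G br \<delta> x0)"
proof (rule lie_superalgebra.intro)
  let ?s = "odd_line_scale scl" and ?M = "odd_line_grading G :: bit \<Rightarrow> ('k \<times> 'g) set"
    and ?b = "odd_line_bracket scl G br \<delta> x0"
  note d = odd_superderivationD[OF der]
  note s = odd_line_scale_apply
  show vs: "vector_space ?s"
    unfolding odd_line_scale_def by (rule vector_space_prod_scale[OF line_prod])
  interpret t: vector_space ?s by (fact vs)
  have grade: "(a, x) \<in> ?M i \<longleftrightarrow> x \<in> G i \<and> (i = 0 \<longrightarrow> a = 0)" for a x i
    by (cases i) (auto simp: odd_line_grading_def)
  have b: "?b (a, x) (b, y) =
      (0, scl (a * b) x0 + scl a (\<delta> y) - scl (psign i * b) (\<delta> x) + br x y)"
    if "x \<in> G i" for a b x y i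
    using that by (simp add: odd_line_bracket_def parity_map_homogeneous d mult.commute)
  \<comment> \<open>Written as sums, these rewrite rules leave no fractions for the simplifier to collect.\<close>
  have sq2: "br x0 x = \<delta> (\<delta> x) + \<delta> (\<delta> x)" for x
    using scale_left_distrib[of "1 / 2" "1 / 2" "br x0 x"] by (simp add: sq)
  have x0r: "br x x0 = - \<delta> (\<delta> x) - \<delta> (\<delta> x)" if "x \<in> G i" for x i
    using br_skew[OF that x0] by (simp add: sq2)
  show "lie_superalgebra_axioms ?s ?M ?b"
  proof
    show "\<exists>S. finite S \<and> t.span S = UNIV"
      unfolding odd_line_scale_def by (rule finite_span_prod[OF line_prod])
    show "t.subspace (?M i)" for i
      by (auto simp: t.subspace_def grade s grading_closed zero_prod_def)
    show "\<exists>u\<in>?M 0. \<exists>v\<in>?M 1. z = u + v" for z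
    proof -
      obtain a x where z: "z = (a, x)" by (cases z)
      obtain u v where "u \<in> G 0" "v \<in> G 1" "x = u + v" using grading_sum by blast
      then show ?thesis
        by (intro bexI[of _ "(0, u)"] bexI[of _ "(a, v)"]) (auto simp: grade z)
    qed
    show "?M 0 \<inter> ?M 1 = {0}"
      using grading_inter by (auto simp: odd_line_grading_def zero_prod_def)
    show "bilinear_map ?s ?s ?s ?b"
      unfolding bilinear_map_iff[OF vs vs vs]
      by (auto simp: odd_line_bracket_def s d br_linear parity_map_linear algebra_simps)
    show even: "?b z w \<in> ?M (i + j)" if "z \<in> ?M i" "w \<in> ?M j" for i j z w
    proof (cases z; cases w)
      fix a x b y assume zw: "z = (a, x)" "w = (b, y)"
      then have h: "x \<in> G i" "y \<in> G j" "i = 0 \<Longrightarrow> a = 0" "j = 0 \<Longrightarrow> b = 0"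
        using that by (auto simp: grade)
      have "scl (a * b) x0 \<in> G (i + j)" "scl a (\<delta> y) \<in> G (i + j)"
          "scl (psign i * b) (\<delta> x) \<in> G (i + j)"
        using h x0 d(6)[OF h(1)] d(6)[OF h(2)]
        by (cases i; cases j; simp add: grading_closed)+
      then show ?thesis
        using br_even[OF h(1,2)] by (simp add: zw b[OF h(1)] grade grading_closed)
    qed
    show "?b z w = - ?s (psign (i * j)) (?b w z)" if "z \<in> ?M i" "w \<in> ?M j" for i j z w
    proof (cases z; cases w)
      fix a x b y assume zw: "z = (a, x)" "w = (b, y)"
      then have h: "x \<in> G i" "y \<in> G j" "i = 0 \<Longrightarrow> a = 0" "j = 0 \<Longrightarrow> b = 0"
        using that by (auto simp: grade)
      show ?thesis
        using h(3,4) br_skew[OF h(1,2)]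
        by (cases i; cases j) (simp_all add: zw b[OF h(1)] b[OF h(2)] s algebra_simps)
    qed
    show "?b z (?b w u) = ?b (?b z w) u + ?s (psign (i * j)) (?b w (?b z u))"
      if "z \<in> ?M i" "w \<in> ?M j" for i j z w u
    proof (cases z; cases w; cases u)
      fix a x b y c v assume zw: "z = (a, x)" "w = (b, y)" "u = (c, v)"
      then have h: "x \<in> G i" "y \<in> G j" "i = 0 \<Longrightarrow> a = 0" "j = 0 \<Longrightarrow> b = 0"
        using that by (auto simp: grade)
      have "?b z w \<in> ?M (i + j)" by (rule even[OF that])
      then have h3: "scl (a * b) x0 + scl a (\<delta> y) - scl (psign i * b) (\<delta> x) + br x y \<in> G (i + j)"
        by (simp add: zw b[OF h(1)] grade)
      note jac = super_jacobi[OF h(1,2), of v]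
      note dd = d(7)[OF h(1), of v] d(7)[OF h(2), of v] d(7)[OF h(1), of y]
      note sk = br_skew[OF h(2) d(6)[OF h(1)]]
      show ?thesis
        using h(3,4)
        unfolding zw b[OF h(1)] b[OF h(2)] b[OF h3]
        by (cases i; cases j)
          (simp_all add: s d(1-5) jac dd sk sq2 x0r[OF h(1)] x0r[OF h(2)] \<delta>x0 br_linear
            algebra_simps)
    qed
  qed
qed

lemma (in lie_superalgebra) odd_superderivation_scale:
  assumes "odd_superderivation scl G br \<delta>"
  shows "odd_superderivation scl G br (\<lambda>x. scl a (\<delta> x))"
  unfolding odd_superderivation_def Vector_Spaces.linear_iff
  using vector_space_axioms odd_superderivationD[OF assms]
  by (auto simp: grading_closed br_linear algebra_simps)

section \<open>Odd-quadratic Lie superalgebras\<close>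

context odd_quadratic_lie_superalgebra
begin

lemma form_linear:
  shows form_add_left: "B (x + y) z = B x z + B y z"
    and form_add_right: "B x (y + z) = B x y + B x z"
    and form_scale_left: "B (scl c x) y = c * B x y"
    and form_scale_right: "B x (scl c y) = c * B x y"
    and form_zero: "B 0 y = 0" "B x 0 = 0"
    and form_minus: "B (- x) y = - B x y" "B x (- y) = - B x y"
    and form_diff: "B (x - y) z = B x z - B y z" "B x (y - z) = B x y - B x z"
proof -
  note b = form_bilinear[unfolded bilinear_map_iff[OF vector_space_axioms vector_space_axioms
        vector_space_field_mult]]
  show add: "B (x + y) z = B x z + B y z" "B x (y + z) = B x y + B x z"
    and sc: "B (scl c x) y = c * B x y" "B x (scl c y) = c * B x y" for x y z c
    by (rule b[THEN conjunct1, rule_format] b[THEN conjunct2, THEN conjunct1, rule_format]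
        b[THEN conjunct2, THEN conjunct2, THEN conjunct1, rule_format]
        b[THEN conjunct2, THEN conjunct2, THEN conjunct2, rule_format])+
  show "B 0 y = 0" "B x 0 = 0"
    using sc(1)[of 0 0 y] sc(2)[of x 0 0] by simp_all
  show m: "B (- x) y = - B x y" "B x (- y) = - B x y" for x y
    using sc(1)[of "- 1" x y] sc(2)[of x "- 1" y] by simp_all
  show "B (x - y) z = B x z - B y z" "B x (y - z) = B x y - B x z"
    using add(1)[of x "- y" z] add(2)[of x y "- z"] by (simp_all add: m)
qed

text \<open>
  An odd supersymmetric form is symmetric: the sign $-1$ occurs only for two odd arguments, where
  the form vanishes.
\<close>

lemma form_commute: "B x y = B y x"
proof -
  obtain u v where x: "u \<in> G 0" "v \<in> G 1" "x = u + v" using grading_sum by blast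
  obtain u' v' where y: "u' \<in> G 0" "v' \<in> G 1" "y = u' + v'" using grading_sum by blast
  have "B u u' = 0" "B u' u = 0" "B v v' = 0" "B v' v = 0"
    using x y form_odd by blast+
  moreover have "B u v' = B v' u" "B v u' = B u' v"
    using form_supersymmetric[OF x(1) y(2)] form_supersymmetric[OF x(2) y(1)] by simp_all
  ultimately show ?thesis by (simp add: x y form_linear)
qed

text \<open>
  Against an even vector only the odd part of \<open>x\<close> contributes.  Hence all signs disappear from the
  terms in \<open>X0\<close> of the double extension.
\<close>

lemma form_parity_map_even:
  assumes "z \<in> G 0"
  shows "B (parity_map G x) z = - B x z"
proof -
  obtain u v where x: "u \<in> G 0" "v \<in> G 1" "x = u + v" using grading_sum by blast
  have "B u z = 0" using x assms form_odd by blast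
  then show ?thesis using x by (simp add: parity_map_add form_linear)
qed

lemma odd_skew_superderivationD:
  assumes "odd_skew_superderivation scl G br B D"
  shows "odd_superderivation scl G br D"
    and "x \<in> G i \<Longrightarrow> B (D x) y = - psign i * B x (D y)"
  using assms by (auto simp: odd_skew_superderivation_def)

text \<open>Skew-supersymmetry of \<open>D\<close> for inhomogeneous arguments.\<close>

lemma form_parity_map_skew:
  assumes "odd_skew_superderivation scl G br B D"
  shows "B (D (parity_map G x)) y = - B x (D y)" "B x (D (parity_map G y)) = - B (D x) y"
proof -
  note d = odd_superderivationD[OF odd_skew_superderivationD(1)[OF assms]]
    and sk = odd_skew_superderivationD(2)[OF assms]
  show 1: "B (D (parity_map G x)) y = - B x (D y)" for x y
  proof -
    obtain u v where x: "u \<in> G 0" "v \<in> G 1" "x = u + v" using grading_sum by blast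
    show ?thesis
      using x sk[OF x(1), of y] sk[OF x(2), of y]
      by (simp add: parity_map_add d form_linear)
  qed
  show "B x (D (parity_map G y)) = - B (D x) y"
    using 1[of y x] by (simp add: form_commute)
qed

end

section \<open>The central extension by the cocycle of a skew superderivation\<close>

context odd_quadratic_lie_superalgebra
begin

text \<open>
  Every axiom on the bracket splits into the one for $\mathfrak g$ and a property of the cocycle $B(D(X), Y)$: it is even,
  as $B$ and $D$ are both odd, it is skew-supersymmetric, and it satisfies the cocycle identity.
\<close>

lemma lie_superalgebra_cext:
  assumes D: "odd_skew_superderivation scl G br B D"
  shows "lie_superalgebra (cext_scale scl) (cext_grading G) (cext_bracket br B D)"
proof (rule lie_superalgebra.intro)
  let ?s = "cext_scale scl" and ?M = "cext_grading G :: bit \<Rightarrow> ('g \<times> 'k) set"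
    and ?b = "cext_bracket br B D"
  note d = odd_superderivationD[OF odd_skew_superderivationD(1)[OF D]]
    and sk = odd_skew_superderivationD(2)[OF D]
  note s = cext_scale_apply
  show vs: "vector_space ?s"
    unfolding cext_scale_def by (rule vector_space_prod_scale[OF prod_line])
  interpret t: vector_space ?s by (fact vs)
  have grade: "(x, s) \<in> ?M i \<longleftrightarrow> x \<in> G i \<and> (i = 1 \<longrightarrow> s = 0)" for x s i
    by (cases i) (auto simp: cext_grading_def)
  show "lie_superalgebra_axioms ?s ?M ?b"
  proof
    show "\<exists>S. finite S \<and> t.span S = UNIV"
      unfolding cext_scale_def by (rule finite_span_prod[OF prod_line])
    show "t.subspace (?M i)" for i
      by (auto simp: t.subspace_def grade s grading_closed zero_prod_def)
    show "\<exists>u\<in>?M 0. \<exists>v\<in>?M 1. z = u + v" for z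
    proof -
      obtain x r where z: "z = (x, r)" by (cases z)
      obtain u v where "u \<in> G 0" "v \<in> G 1" "x = u + v" using grading_sum by blast
      then show ?thesis
        by (intro bexI[of _ "(u, r)"] bexI[of _ "(v, 0)"]) (auto simp: grade z)
    qed
    show "?M 0 \<inter> ?M 1 = {0}"
      using grading_inter by (auto simp: cext_grading_def zero_prod_def)
    show "bilinear_map ?s ?s ?s ?b"
      unfolding bilinear_map_iff[OF vs vs vs]
      by (auto simp: cext_bracket_def s d br_linear form_linear algebra_simps)
    have \<omega>_even: "B (D x) y = 0" if "x \<in> G i" "y \<in> G j" "i \<noteq> j" for x y i j
      using form_odd[OF d(6)[OF that(1)], of y] that by (cases i; cases j) auto
    show "?b z w \<in> ?M (i + j)" if "z \<in> ?M i" "w \<in> ?M j" for i j z w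
      using that br_even[of _ i _ j] \<omega>_even[of _ i _ j]
      by (cases z; cases w; cases i; cases j) (auto simp: cext_bracket_def grade)
    show "?b z w = - ?s (psign (i * j)) (?b w z)" if "z \<in> ?M i" "w \<in> ?M j" for i j z w
    proof (cases z; cases w)
      fix x r y t assume zw: "z = (x, r)" "w = (y, t)"
      then have h: "x \<in> G i" "y \<in> G j"
        using that by (auto simp: grade)
      have "B (D x) y = - psign (i * j) * B (D y) x"
        using sk[OF h(1), of y] \<omega>_even[OF h] \<omega>_even[OF h(2,1)] form_commute[of x "D y"]
        by (cases i; cases j) auto
      then show ?thesis
        using br_skew[OF h] by (simp add: zw cext_bracket_def s)
    qed
    show "?b z (?b w u) = ?b (?b z w) u + ?s (psign (i * j)) (?b w (?b z u))"
      if "z \<in> ?M i" "w \<in> ?M j" for i j z w u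
    proof (cases z; cases w; cases u)
      fix x r y t v q assume zw: "z = (x, r)" "w = (y, t)" "u = (v, q)"
      then have h: "x \<in> G i" "y \<in> G j"
        using that by (auto simp: grade)
      \<comment> \<open>The cocycle identity: in $B([X, D(Y)], Z)$ the bracket is flipped before invariance applies.\<close>
      have "B (D (br x y)) v = B (D x) (br y v) - psign (i * j) * B (D y) (br x v)"
        using br_skew[OF h(1) d(6)[OF h(2)]]
        by (cases i; cases j) (simp_all add: d(7)[OF h(1)] form_linear form_invariant)
      then show ?thesis
        using super_jacobi[OF h] by (simp add: zw cext_bracket_def s)
    qed
  qed
qed

lemma gode_derivation_apply:
  assumes "X0 \<in> G 0"
  shows "gode_derivation G B D X0 (x, s) = (D x, B x X0)"
  by (simp add: gode_derivation_def form_parity_map_even[OF assms])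

text \<open>
  Only the $e^*$-component is not immediate: $B([X, Y], X_0)$ has to equal
  $B(D^2(X), Y) + (-1)^i B(D(X), D(Y))$ for $X$ of parity $i$.  By skewness of \<open>D\<close> the two summands agree, and twice the
  first is $B([X_0, X], Y)$.
\<close>

lemma odd_superderivation_gode_derivation:
  assumes D: "odd_skew_superderivation scl G br B D"
    and X0: "X0 \<in> G 0"
    and sq: "\<And>x. D (D x) = scl (1 / 2) (br X0 x)"
  shows "odd_superderivation (cext_scale scl) (cext_grading G) (cext_bracket br B D)
    (gode_derivation G B D X0)"
proof -
  note d = odd_superderivationD[OF odd_skew_superderivationD(1)[OF D]]
    and sk = odd_skew_superderivationD(2)[OF D]
  interpret c: lie_superalgebra "cext_scale scl" "cext_grading G" "cext_bracket br B D"
    by (rule lie_superalgebra_cext[OF D])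
  have "B (br x y) X0 = B (D (D x)) y + psign i * B (D x) (D y)" if "x \<in> G i" for x y i
  proof -
    have "B (D (D x)) y = psign i * B (D x) (D y)"
      using sk[OF d(6)[OF that], of y] by (cases i) simp_all
    moreover have "B (br x y) X0 = 2 * B (D (D x)) y"
      using form_commute[of "br x y" X0] form_invariant[of X0 x y]
      by (simp add: sq form_linear)
    ultimately show ?thesis by simp
  qed
  then show ?thesis
    unfolding odd_superderivation_def Vector_Spaces.linear_iff
    using c.vector_space_axioms X0
    by (auto simp: gode_derivation_apply cext_scale_apply cext_grading_def cext_bracket_def d
        form_linear form_odd split: if_splits intro: d(6)[of _ 0, simplified] d(6)[of _ 1, simplified])
qed

end

section \<open>The generalized odd double extension\<close>

lemma (in lie_superalgebra) parity_map_cext: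
  assumes "lie_superalgebra (cext_scale scl) (cext_grading G) c"
  shows "parity_map (cext_grading G) (x, s :: 'k) = (parity_map G x, s)"
proof -
  interpret c: lie_superalgebra "cext_scale scl" "cext_grading G" c by (fact assms)
  obtain u v where x: "u \<in> G 0" "v \<in> G 1" "x = u + v" using grading_sum by blast
  have "parity_map (cext_grading G) ((u, s) + (v, 0)) = (u, s) - (v, 0)"
    using x by (intro c.parity_map_add) (auto simp: cext_grading_def)
  then show ?thesis using x by (simp add: parity_map_add)
qed

lemma (in lie_superalgebra) gode_scale_apply:
  "gode_scale scl c (a, x, s) = (c * a, scl c x, c * s)"
proof -
  interpret k: vector_space "(*) :: 'k \<Rightarrow> 'k \<Rightarrow> 'k" by (rule vector_space_field_mult)
  interpret c: vector_space "cext_scale scl"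
    unfolding cext_scale_def by (rule vector_space_prod_scale[OF prod_line])
  interpret vector_space_prod "(*) :: 'k \<Rightarrow> 'k \<Rightarrow> 'k" "cext_scale scl" ..
  show ?thesis by (simp add: gode_scale_def odd_line_scale_def scale_prod cext_scale_apply)
qed

lemma (in lie_superalgebra) span_gode_scale:
  "module.span (gode_scale scl) ({0} \<times> S \<times> {0}) = {0} \<times> span S \<times> {0}"
proof -
  interpret k: vector_space "(*) :: 'k \<Rightarrow> 'k \<Rightarrow> 'k" by (rule vector_space_field_mult)
  interpret c: vector_space_prod scl "(*) :: 'k \<Rightarrow> 'k \<Rightarrow> 'k" ..
  interpret t: vector_space_prod "(*) :: 'k \<Rightarrow> 'k \<Rightarrow> 'k" c.scale ..
  show ?thesis
    by (simp add: gode_scale_def odd_line_scale_def cext_scale_def t.span_Times_sing1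
        c.span_Times_sing2)
qed

lemma (in lie_superalgebra) dim_gode_scale:
  assumes "module.subspace ((*) :: 'k \<Rightarrow> 'k \<Rightarrow> 'k) L" "subspace S"
  shows "vector_space.dim (gode_scale scl) (L \<times> S \<times> {0}) =
    vector_space.dim ((*) :: 'k \<Rightarrow> 'k \<Rightarrow> 'k) L + dim S"
proof -
  interpret k: vector_space "(*) :: 'k \<Rightarrow> 'k \<Rightarrow> 'k" by (rule vector_space_field_mult)
  interpret c: vector_space_prod scl "(*) :: 'k \<Rightarrow> 'k \<Rightarrow> 'k" ..
  have "c.p.dim (S \<times> {0}) = dim S + k.dim {0}"
    by (rule dim_prod_Times[OF prod_line assms(2) k.subspace_single_0])
  also have "k.dim {0} = 0" by (rule dim_field_zero)
  finally have "c.p.dim (S \<times> {0}) = dim S" by simp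
  then show ?thesis
    using dim_prod_Times[OF vector_space_field_mult ex_finite_span_field c.p.vector_space_axioms
        finite_span_prod[OF prod_line] assms(1) c.subspace_Times[OF assms(2) k.subspace_single_0]]
    by (simp add: gode_scale_def odd_line_scale_def cext_scale_def)
qed

locale odd_double_extension_data = odd_quadratic_lie_superalgebra scl G br B
  for scl :: "'k::field_char_0 \<Rightarrow> 'g::ab_group_add \<Rightarrow> 'g" and G br B +
  fixes D :: "'g \<Rightarrow> 'g" and X0 :: 'g and l0 :: 'k
  assumes D: "odd_skew_superderivation scl G br B D"
    and X0: "X0 \<in> G 0"
    and D_X0: "D X0 = 0"
    and D_square: "\<And>x. D (D x) = scl (1 / 2) (br X0 x)"
begin

abbreviation "brT \<equiv> gode_bracket scl G br B D X0 l0"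

lemmas D_superderivation = odd_superderivationD[OF odd_skew_superderivationD(1)[OF D]]

sublocale c: lie_superalgebra "cext_scale scl" "cext_grading G" "cext_bracket br B D"
  by (rule lie_superalgebra_cext[OF D])

lemma gode_derivation_odd_superderivation:
  "odd_superderivation (cext_scale scl) (cext_grading G) (cext_bracket br B D)
    (gode_derivation G B D X0)"
  by (rule odd_superderivation_gode_derivation[OF D X0 D_square])

lemma gode_bracket_eq_odd_line_bracket:
  "brT = odd_line_bracket (cext_scale scl) (cext_grading G) (cext_bracket br B D)
    (gode_derivation G B D X0) (X0, l0)"
  by (auto simp: fun_eq_iff gode_bracket_def odd_line_bracket_def cext_scale_apply
      cext_bracket_def gode_derivation_apply[OF X0] parity_map_cext[OF c.lie_superalgebra_axioms]
      form_parity_map_even[OF X0])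

lemma gode_bracket_apply:
  "brT (a, x, s) (b, y, t) =
    (0, scl (a * b) X0 + scl a (D y) - scl b (D (parity_map G x)) + br x y,
     a * b * l0 + a * B y X0 + b * B x X0 + B (D x) y)"
  by (simp add: gode_bracket_def form_parity_map_even[OF X0])

text \<open>
  The $e^*$-components of both sides vanish because $D(X_0) = 0$: on the left, skewness turns
  $B(D(X), X_0)$ into $\pm B(X, D(X_0))$, and on the right stands a multiple of $B(D(X_0), X)$.
\<close>

lemma gode_derivation_square:
  "gode_derivation G B D X0 (gode_derivation G B D X0 z) =
    cext_scale scl (1 / 2) (cext_bracket br B D (X0, l0) z)"
proof (cases z)
  case (Pair x s)
  have "B (D x) X0 = 0"
    using form_parity_map_skew(2)[OF D, of x X0] X0
    by (simp add: parity_map_homogeneous D_X0 D_superderivation form_zero)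
  then show ?thesis
    by (simp add: Pair gode_derivation_apply[OF X0] cext_bracket_def cext_scale_apply D_square
        D_X0 form_zero)
qed

sublocale t: lie_superalgebra "gode_scale scl" "gode_grading G" brT
  unfolding gode_scale_def gode_grading_def gode_bracket_eq_odd_line_bracket
proof (rule c.lie_superalgebra_odd_line[OF gode_derivation_odd_superderivation _ _
      gode_derivation_square])
  show "(X0, l0) \<in> cext_grading G 0" using X0 by (simp add: cext_grading_def)
  show "gode_derivation G B D X0 (X0, l0) = 0"
    using form_odd[OF X0 X0] by (simp add: gode_derivation_apply[OF X0] D_X0 zero_prod_def)
qed

lemma gode_generalized_semidirect_product:
  "generalized_semidirect_product
     (cext_scale scl) (cext_grading G) (cext_bracket br B D)
     (gode_Omega scl G B D X0) (gode_zeta scl X0 l0) brT"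
  unfolding generalized_semidirect_product_def
proof (intro conjI allI)
  show "lie_superalgebra (cext_scale scl) (cext_grading G) (cext_bracket br B D)"
    by (rule c.lie_superalgebra_axioms)
  show "lie_superalgebra (odd_line_scale (cext_scale scl)) (odd_line_grading (cext_grading G)) brT"
    using t.lie_superalgebra_axioms by (simp add: gode_scale_def gode_grading_def)
  show "Vector_Spaces.linear (*) (cext_scale scl) (\<lambda>a. gode_Omega scl G B D X0 a x)" for x
    unfolding Vector_Spaces.linear_iff gode_Omega_def
    using vector_space_field_mult c.vector_space_axioms by (simp add: c.scale_left_distrib)
  show "odd_superderivation (cext_scale scl) (cext_grading G) (cext_bracket br B D)
      (gode_Omega scl G B D X0 a)" for a
    using c.odd_superderivation_scale[OF gode_derivation_odd_superderivation]
    by (simp add: gode_Omega_def[abs_def])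
  show "bilinear_map (*) (*) (cext_scale scl) (gode_zeta scl X0 l0)"
    unfolding bilinear_map_iff[OF vector_space_field_mult vector_space_field_mult
        c.vector_space_axioms]
    by (simp add: gode_zeta_def cext_scale_apply algebra_simps)
  show "gode_zeta scl X0 l0 a b \<in> cext_grading G 0" for a b
    using X0 by (simp add: gode_zeta_def cext_scale_apply cext_grading_def grading_closed)
  show "brT (0, x) (0, y) = (0, cext_bracket br B D x y)" for x y
    by (cases x; cases y) (simp add: gode_bracket_apply cext_bracket_def)
  show "brT (a, 0) (0, x) = (0, gode_Omega scl G B D X0 a x)" for a x
    by (cases x) (simp add: gode_bracket_apply zero_prod_def gode_Omega_def
        gode_derivation_apply[OF X0] cext_scale_apply D_superderivation br_zero form_zero)
  have "parity_map G 0 = 0" using parity_map_linear(2)[of 0 0] by simp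
  then show "brT (a, 0) (b, 0) = (0, gode_zeta scl X0 l0 a b)" for a b
    by (simp add: gode_bracket_apply zero_prod_def gode_zeta_def cext_scale_apply
        D_superderivation br_zero form_zero)
qed

text \<open>
  Invariance explains the coefficients of $e^*$ in the bracket: $B([X, Y], e) = B(X, [Y, e])$ on
  $\mathfrak t$ forces the coefficient in $[X, Y]$ to be $B(D(X), Y)$, and
  $B([e, X], e) = B([e, e], X)$, up to sign, forces the one in $[e, X]$ to be a multiple of $B(X, X_0)$.
  The scalar \<open>l0\<close> enters both sides symmetrically and stays free.
\<close>

lemma gode_odd_quadratic:
  "odd_quadratic_lie_superalgebra (gode_scale scl) (gode_grading G) brT (gode_form B)"
proof (intro odd_quadratic_lie_superalgebra.intro odd_quadratic_lie_superalgebra_axioms.intro)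
  show "lie_superalgebra (gode_scale scl) (gode_grading G) brT"
    by (rule t.lie_superalgebra_axioms)
  have grade: "(a, x, s) \<in> gode_grading G i \<longleftrightarrow>
      x \<in> G i \<and> (i = 0 \<longrightarrow> a = 0) \<and> (i = 1 \<longrightarrow> s = 0)" for a s :: 'k and x i
    by (cases i) (auto simp: gode_grading_def odd_line_grading_def cext_grading_def)
  show "bilinear_map (gode_scale scl) (gode_scale scl) (*) (gode_form B)"
    unfolding bilinear_map_iff[OF t.vector_space_axioms t.vector_space_axioms
        vector_space_field_mult]
    by (auto simp: gode_form_def gode_scale_apply form_linear algebra_simps)
  show "gode_form B z w = psign (i * j) * gode_form B w z"
    if "z \<in> gode_grading G i" "w \<in> gode_grading G j" for i j z w
  proof (cases z; cases w)
    fix a xs b yt assume zw: "z = (a, xs)" "w = (b, yt)"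
    obtain x s y t where xy: "xs = (x, s)" "yt = (y, t)" by (metis surj_pair)
    show ?thesis
      using that form_supersymmetric[of x i y j]
      by (cases i; cases j) (auto simp: zw xy grade gode_form_def)
  qed
  show "gode_form B z w = 0"
    if "z \<in> gode_grading G i" "w \<in> gode_grading G i" for i z w
    using that form_odd
    by (cases z; cases w; cases i) (auto simp: grade gode_form_def)
  show "gode_form B (brT z w) u = gode_form B z (brT w u)" for z w u
  proof -
    obtain a x r b y s c v t where "z = (a, x, r)" "w = (b, y, s)" "u = (c, v, t)"
      by (metis surj_pair)
    then show ?thesis
      by (simp add: gode_form_def gode_bracket_apply form_linear form_parity_map_skew[OF D]
          form_invariant form_commute[of X0] algebra_simps)
  qed
  show "z = 0" if h: "\<forall>w. gode_form B z w = 0" for z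
  proof -
    obtain a x s where z: "z = (a, x, s)" by (metis surj_pair)
    have "B x y = 0" for y using h[rule_format, of "(0, y, 0)"] by (simp add: z gode_form_def)
    then have "x = 0" by (intro form_nondegenerate) blast
    moreover have "a = 0" "s = 0"
      using h[rule_format, of "(0, 0, 1)"] h[rule_format, of "(1, 0, 0)"]
      by (simp_all add: z gode_form_def form_zero)
    ultimately show ?thesis by (simp add: z zero_prod_def)
  qed
qed

lemma gode_bracket_even_odd:
  assumes "x \<in> G 0" "y \<in> G 1"
  shows "brT (0, x, s) (a, y, 0) = (0, br x y - scl a (D x), 0)"
proof -
  have "D x \<in> G 1" using D_superderivation(6)[OF assms(1)] by simp
  then show ?thesis
    using assms form_odd[OF assms(1) X0] form_odd[of "D x" 1 y]
    by (simp add: gode_bracket_apply parity_map_homogeneous)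
qed

text \<open>
  Below the top, brackets with $\mathfrak t_{\bar 0}$ are those with $\mathfrak g_{\bar 0}$.  At the top the
  brackets span $V_{m-1} + D(\mathfrak g_{\bar 0})$, which is all of $V_m$ because \<open>em\<close> lies in
  $D(\mathfrak g_{\bar 0})$ and generates $V_m$ modulo $V_{m-1}$.
\<close>

lemma weak_filiform_gode:
  assumes wf: "weak_filiform scl G br m V" and m: "m \<ge> 2"
    and em: "quotient_basis scl (V m) (V (m - 1)) em" "em \<in> D ` G 0"
  shows "weak_filiform (gode_scale scl) (gode_grading G) brT (m + 1) (gode_flag m V)"
proof -
  interpret k: vector_space "(*) :: 'k \<Rightarrow> 'k \<Rightarrow> 'k" by (rule vector_space_field_mult)
  have V: "V m = G 1" "V 1 = {0}" "dim (G 1) = m"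
    and Vsub: "\<And>i. i \<in> {1..m} \<Longrightarrow> subspace (V i)"
    and Vi: "\<And>i. i \<in> {2..m} \<Longrightarrow> V (i - 1) \<subset> V i"
      "\<And>i. i \<in> {2..m} \<Longrightarrow> dim (V i) = i"
      "\<And>i. i \<in> {2..m} \<Longrightarrow> span {br x v | x v. x \<in> G 0 \<and> v \<in> V i} = V (i - 1)"
    using wf by (auto simp: weak_filiform_def)
  have Vodd: "V i \<subseteq> G 1" if "i \<in> {1..m}" for i
  proof -
    have "i \<le> m" "1 \<le> i" using that by auto
    then show ?thesis
    proof (induction rule: inc_induct)
      case base
      then show ?case by (simp add: V)
    next
      case (step n)
      then show ?case using Vi(1)[of "Suc n"] by auto
    qed
  qed
  have G0: "gode_grading G 0 = {0 :: 'k} \<times> G 0 \<times> UNIV"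
    and G1: "gode_grading G 1 = (UNIV :: 'k set) \<times> G 1 \<times> {0}"
    by (auto simp: gode_grading_def odd_line_grading_def cext_grading_def)
  have top: "gode_flag m V (m + 1) = (UNIV :: 'k set) \<times> V m \<times> {0}"
    and below: "i \<le> m \<Longrightarrow> gode_flag m V i = {0 :: 'k} \<times> V i \<times> {0}" for i
    by (simp_all add: gode_flag_def)
  have dim_top: "t.dim ((UNIV :: 'k set) \<times> V m \<times> {0}) = m + 1"
    using dim_gode_scale[OF k.subspace_UNIV Vsub[of m]] m by (simp add: V dim_field_UNIV)
  have dim_below: "t.dim ({0 :: 'k} \<times> V i \<times> {0}) = i" if "i \<in> {2..m}" for i
    using dim_gode_scale[OF k.subspace_single_0 Vsub[of i]] that by (simp add: Vi dim_field_zero)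
  have sub: "t.subspace (gode_flag m V i)" if "i \<in> {1..m + 1}" for i
  proof (cases "i = m + 1")
    case True
    then show ?thesis unfolding True top using Vsub[of m] m
      by (auto simp: t.subspace_def subspace_def zero_prod_def gode_scale_apply)
  next
    case False
    then have "i \<le> m" using that by simp
    then show ?thesis unfolding below[OF \<open>i \<le> m\<close>] using Vsub[of i] that
      by (auto simp: t.subspace_def subspace_def zero_prod_def gode_scale_apply)
  qed
  have span_below: "t.span {brT x v |x v. x \<in> gode_grading G 0 \<and> v \<in> gode_flag m V i} =
      gode_flag m V (i - 1)" if "i \<in> {2..m}" for i
  proof -
    have odd: "v \<in> G 1" if "v \<in> V i" for v using that Vodd[of i] \<open>i \<in> {2..m}\<close> by auto
    have "{brT x v |x v. x \<in> gode_grading G 0 \<and> v \<in> gode_flag m V i} =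
        {0} \<times> {br x v |x v. x \<in> G 0 \<and> v \<in> V i} \<times> {0}"
      using that by (force simp: G0 below gode_bracket_even_odd odd)
    moreover have "i - 1 \<le> m" using that by (simp add: le_diff_conv)
    ultimately show ?thesis using that by (simp only: span_gode_scale Vi below)
  qed
  let ?S = "{br x v - scl a (D x) |x v a. x \<in> G 0 \<and> v \<in> G 1}"
  have span_S: "span ?S = G 1"
  proof
    have "?S \<subseteq> G 1"
      using br_even[of _ 0 _ 1] D_superderivation(6)[of _ 0] by (auto intro!: grading_closed)
    then show "span ?S \<subseteq> G 1" by (rule span_minimal[OF _ subspace_grading])
    obtain x where x: "x \<in> G 0" "em = D x" using em(2) by blast
    \<comment> \<open>$D(x) = [x, -e]$, so \<open>em\<close> itself is one of the brackets.\<close>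
    have "em = br x 0 - scl (- 1) (D x)" by (simp add: x br_zero)
    then have "em \<in> ?S" using x(1) grading_closed(1)[of 1] by blast
    then have em_S: "em \<in> span ?S" by (rule span_base)
    have "br x v = br x v - scl 0 (D x)" for x v by simp
    then have "{br x v |x v. x \<in> G 0 \<and> v \<in> G 1} \<subseteq> ?S" by blast
    then have "span {br x v |x v. x \<in> G 0 \<and> v \<in> G 1} \<subseteq> span ?S" by (rule span_mono)
    moreover have "span {br x v |x v. x \<in> G 0 \<and> v \<in> G 1} = V (m - 1)"
      using Vi(3)[of m] m unfolding V by simp
    ultimately have V_S: "V (m - 1) \<subseteq> span ?S" by blast
    show "G 1 \<subseteq> span ?S"
    proof
      fix v assume "v \<in> G 1"
      then obtain c where "v - scl c em \<in> V (m - 1)"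
        using em(1) by (auto simp: quotient_basis_def V)
      then have "(v - scl c em) + scl c em \<in> span ?S"
        using V_S em_S by (intro span_add span_scale) auto
      then show "v \<in> span ?S" by simp
    qed
  qed
  have "{brT x v |x v. x \<in> gode_grading G 0 \<and> v \<in> gode_flag m V (m + 1)} =
      {0} \<times> ?S \<times> {0}" (is "?L = ?R")
  proof (rule set_eqI, rule iffI)
    fix z assume "z \<in> ?L"
    then obtain x s a y where "x \<in> G 0" "y \<in> G 1" "z = brT (0, x, s) (a, y, 0)"
      unfolding G0 top V by auto
    then show "z \<in> ?R" by (auto simp: gode_bracket_even_odd)
  next
    fix z assume "z \<in> ?R"
    then obtain x y a where xy: "x \<in> G 0" "y \<in> G 1" "z = (0, br x y - scl a (D x), 0)"
      by auto
    then have "z = brT (0, x, 0) (a, y, 0)" by (simp add: gode_bracket_even_odd)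
    moreover have "(0 :: 'k, x, 0 :: 'k) \<in> gode_grading G 0"
        "(a, y, 0 :: 'k) \<in> gode_flag m V (m + 1)"
      using xy unfolding G0 top V by auto
    ultimately show "z \<in> ?L" by blast
  qed
  then have span_top: "t.span {brT x v |x v. x \<in> gode_grading G 0 \<and> v \<in> gode_flag m V (m + 1)}
      = gode_flag m V m"
    by (simp only: span_gode_scale span_S below[OF order_refl] V)
  show ?thesis
    unfolding weak_filiform_def
  proof (intro conjI ballI)
    fix i assume i: "i \<in> {2..m + 1}"
    show "gode_flag m V (i - 1) \<subset> (gode_flag m V i :: ('k \<times> 'g \<times> 'k) set)"
    proof (cases "i = m + 1")
      case True
      have "(1, 0, 0) \<in> (UNIV :: 'k set) \<times> V m \<times> {0 :: 'k}"
        by (simp add: V grading_closed)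
      moreover have "(1, 0, 0) \<notin> {0 :: 'k} \<times> V m \<times> {0 :: 'k}" by simp
      ultimately show ?thesis
        unfolding True top add_diff_cancel_right' below[OF order_refl] by blast
    next
      case False
      then have le: "i \<le> m" "i - 1 \<le> m" and "i \<in> {2..m}" using i by auto
      from Vi(1)[OF this(3)] show ?thesis unfolding below[OF le(1)] below[OF le(2)] by blast
    qed
    show "t.dim (gode_flag m V i) = i"
    proof (cases "i = m + 1")
      case True
      show ?thesis unfolding True top by (rule dim_top)
    next
      case False
      then have "i \<le> m" "i \<in> {2..m}" using i by auto
      then show ?thesis unfolding below[OF \<open>i \<le> m\<close>] by (intro dim_below)
    qed
    show "t.span {brT x v |x v. x \<in> gode_grading G 0 \<and> v \<in> gode_flag m V i} =
        gode_flag m V (i - 1)"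
    proof (cases "i = m + 1")
      case True
      show ?thesis unfolding True add_diff_cancel_right' by (rule span_top)
    next
      case False
      then show ?thesis using i by (intro span_below) auto
    qed
  next
    show "0 < m + 1" by simp
    show "t.dim (gode_grading G 1) = m + 1" using dim_top unfolding G1 V(1) .
    show "gode_flag m V (m + 1) = (gode_grading G 1 :: ('k \<times> 'g \<times> 'k) set)"
      unfolding G1 top V(1) ..
    show "gode_flag m V 1 = {0 :: 'k \<times> 'g \<times> 'k}"
      using m by (simp add: below V(2)[simplified] zero_prod_def)
  qed (rule sub)
qed

end

theorem theorem3p1:
  fixes scl :: "'k::{alg_closed_field, field_char_0} \<Rightarrow> 'g::ab_group_add \<Rightarrow> 'g"
    and G :: "bit \<Rightarrow> 'g set"
    and br :: "'g \<Rightarrow> 'g \<Rightarrow> 'g"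
    and B :: "'g \<Rightarrow> 'g \<Rightarrow> 'k"
    and m :: nat
    and V :: "nat \<Rightarrow> 'g set"
    and e_m :: 'g
    and D :: "'g \<Rightarrow> 'g"
    and X0 :: 'g
    and l0 :: 'k
  assumes "odd_quadratic_lie_superalgebra scl G br B"
    and "vector_space.dim scl (G 1) = m"
    and "m \<ge> 3"
    and "weak_filiform scl G br m V"
    and "quotient_basis scl (V m) (V (m - 1)) e_m"
    and "odd_skew_superderivation scl G br B D"
    and "X0 \<in> G 0"
    and "D X0 = 0"
    and "\<forall>x. D (D x) = scl (1 / 2) (br X0 x)"
    and "e_m \<in> D ` G 0"
  shows "generalized_semidirect_product
           (cext_scale scl) (cext_grading G) (cext_bracket br B D)
           (gode_Omega scl G B D X0) (gode_zeta scl X0 l0)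
           (gode_bracket scl G br B D X0 l0) \<and>
         odd_quadratic_lie_superalgebra
           (gode_scale scl) (gode_grading G)
           (gode_bracket scl G br B D X0 l0) (gode_form B) \<and>
         weak_filiform
           (gode_scale scl) (gode_grading G)
           (gode_bracket scl G br B D X0 l0) (m + 1) (gode_flag m V)"
proof -
  interpret odd_double_extension_data scl G br B D X0 l0
    using assms by (intro odd_double_extension_data.intro odd_double_extension_data_axioms.intro) auto
  have "m \<ge> 2" using assms(3) by simp
  from weak_filiform_gode[OF assms(4) this assms(5,10)]
  show ?thesis
    using gode_generalized_semidirect_product gode_odd_quadratic by blast
qed

end
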